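(* Let $G$ be a $3E$-group. If $|G|\leq 3^{10}$, then $G$ is nilpotent of class at most $2$.
   Context: A group $G$ is called an $E$-group if every element of $G$ commutes with each of its endomorphic images, i.e. $x\,x^{\alpha}=x^{\alpha}x$ for every $x\in G$ and every endomorphism $\alpha$ of $G$. A $3E$-group is an $E$-group which is also a $3$-group. *)

theory Defs
  imports "HOL-Algebra.Algebra"
begin

definition E_group :: "('a, 'b) monoid_scheme \<Rightarrow> bool" where
  "E_group G \<longleftrightarrow> group G \<and>
     (\<forall>\<alpha> \<in> hom G G. \<forall>x \<in> carrier G. x \<otimes>\<^bsub>G\<^esub> \<alpha> x = \<alpha> x \<otimes>\<^bsub>G\<^esub> x)"

text \<open>The name \<open>prime\<close> is qualified because HOL-Algebra has a constant of the same name
  for primes of a monoid.  As \<open>group.ord\<close> is 0 on elements of infinite order, the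
  definition forces every element to have finite order; the group itself may be infinite.\<close>

definition p_group :: "nat \<Rightarrow> ('a, 'b) monoid_scheme \<Rightarrow> bool" where
  "p_group p G \<longleftrightarrow> Factorial_Ring.prime p \<and> group G \<and>
     (\<forall>x \<in> carrier G. \<exists>n. group.ord G x = p ^ n)"

definition pE_group :: "nat \<Rightarrow> ('a, 'b) monoid_scheme \<Rightarrow> bool" where
  "pE_group p G \<longleftrightarrow> E_group G \<and> p_group p G"

definition commutator_subgroup ::
  "('a, 'b) monoid_scheme \<Rightarrow> 'a set \<Rightarrow> 'a set \<Rightarrow> 'a set" where
  "commutator_subgroup G H K =
     generate G {h \<otimes>\<^bsub>G\<^esub> k \<otimes>\<^bsub>G\<^esub> inv\<^bsub>G\<^esub> h \<otimes>\<^bsub>G\<^esub> inv\<^bsub>G\<^esub> k | h k. h \<in> H \<and> k \<in> K}"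

text \<open>Indexed from 0: \<open>lower_central_series G n\<close> is the term usually written
  \<open>\<gamma>\<close> with subscript \<open>n + 1\<close>.\<close>

primrec lower_central_series :: "('a, 'b) monoid_scheme \<Rightarrow> nat \<Rightarrow> 'a set" where
  "lower_central_series G 0 = carrier G"
| "lower_central_series G (Suc n) =
     commutator_subgroup G (lower_central_series G n) (carrier G)"

definition nilpotent_of_class_at_most :: "nat \<Rightarrow> ('a, 'b) monoid_scheme \<Rightarrow> bool" where
  "nilpotent_of_class_at_most c G \<longleftrightarrow> group G \<and> lower_central_series G c = {\<one>\<^bsub>G\<^esub>}"

end

theory Submission
  imports Defs
begin

text \<open>
  Every element of an \<open>E\<close>-group commutes with its conjugates, so \<open>G\<close> is 2-Engel; hence \<open>[x,y,z]\<close> is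
  alternating, has order dividing 3, and is central. Mapping a cyclic quotient of order 3 onto
  a subgroup of order 3 shows that all elements of order 3 are central.

  Suppose \<open>c = [x,y,z] \<noteq> 1\<close> and put \<open>D = G'\<close>, which is abelian, and \<open>P = D \<inter> Z(G)\<close>. Commutation of
  \<open>[x,y]\<close>, \<open>[y,z]\<close>, \<open>[z,x]\<close> with \<open>x\<close>, \<open>y\<close>, \<open>z\<close> gives \<open>|D/P| \<ge> 27\<close> and \<open>|G/D| \<ge> 27\<close>. The cube map sends
  \<open>D\<close> into \<open>P\<close> with kernel inside \<open>P\<close>, so \<open>|P| \<ge> |D/P|\<close>. If the three commutators and \<open>P\<close> do not
  generate \<open>D\<close>, then \<open>|D/P| \<ge> 54\<close> and \<open>|G| \<ge> 27 \<cdot> 54\<^sup>2 > 3\<^sup>1\<^sup>0\<close>. Otherwise \<open>[D,G] = \<langle>c\<rangle>\<close>, and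
  \<open>|G| \<le> 3\<^sup>1\<^sup>0\<close> would force \<open>|G/D| \<le> 81\<close>. Then the cubes of \<open>G/D\<close> form a group of order at most 3,
  so \<open>{g. g\<^sup>3 \<in> D}\<close> has index at most 3 and every commutator is \<open>[u,v]\<close> with \<open>u\<^sup>3 \<in> D\<close> or \<open>v\<^sup>3 \<in> D\<close>.
  Hence \<open>[u,v]\<^sup>3 \<in> [D,G] = \<langle>c\<rangle>\<close>, so \<open>D\<close> has at most 3 cubes, whereas \<open>|D/P| \<ge> 27\<close> shows that it has at
  least 27.
\<close>

section \<open>Commutators and centralizers\<close>

context group
begin

definition comm :: "'a \<Rightarrow> 'a \<Rightarrow> 'a"
  where "comm a b = a \<otimes> b \<otimes> inv a \<otimes> inv b"

lemma cancel_left: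
  assumes "a \<in> carrier G" "b \<in> carrier G"
  shows "a \<otimes> (inv a \<otimes> b) = b" "inv a \<otimes> (a \<otimes> b) = b"
  using assms by (simp_all flip: m_assoc)

text \<open>These rules bring group words into right-associated reduced form, so identities that
  hold in free groups follow by simplification.\<close>

lemmas word_simps = m_assoc inv_mult_group cancel_left

lemma comm_closed [simp, intro]:
  "a \<in> carrier G \<Longrightarrow> b \<in> carrier G \<Longrightarrow> comm a b \<in> carrier G"
  by (simp add: comm_def)

lemma comm_eq_one_iff:
  assumes "a \<in> carrier G" "b \<in> carrier G"
  shows "comm a b = \<one> \<longleftrightarrow> a \<otimes> b = b \<otimes> a"
proof -
  have *: "comm a b \<otimes> (b \<otimes> a) = a \<otimes> b"
    using assms by (simp add: comm_def word_simps)
  have "comm a b \<otimes> (b \<otimes> a) = b \<otimes> a \<longleftrightarrow> comm a b = \<one>"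
    using assms by (simp add: r_cancel_one')
  then show ?thesis
    using * by simp
qed

lemma inv_comm_eq:
  "a \<in> carrier G \<Longrightarrow> b \<in> carrier G \<Longrightarrow> inv (comm a b) = comm b a"
  by (simp add: comm_def word_simps)

lemma comm_one [simp]:
  "a \<in> carrier G \<Longrightarrow> comm \<one> a = \<one>" "a \<in> carrier G \<Longrightarrow> comm a \<one> = \<one>"
  by (simp_all add: comm_def word_simps)

text \<open>The Hall-Witt identity, arranged so that each conjugation sits in a second argument,
  where \<open>comm_comm_conj\<close> can remove it.\<close>

lemma hall_witt:
  assumes "a \<in> carrier G" "b \<in> carrier G" "c \<in> carrier G"
  shows "comm (comm a b) (b \<otimes> c \<otimes> inv b) \<otimes> comm (comm b c) (c \<otimes> a \<otimes> inv c)
    \<otimes> comm (comm c a) (a \<otimes> b \<otimes> inv a) = \<one>"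
  using assms by (simp add: comm_def word_simps)

lemma conj_comm:
  assumes "a \<in> carrier G" "b \<in> carrier G" "g \<in> carrier G"
  shows "g \<otimes> comm a b \<otimes> inv g = comm (g \<otimes> a \<otimes> inv g) (g \<otimes> b \<otimes> inv g)"
  using assms by (simp add: comm_def word_simps)

lemma comm_mult_left:
  assumes "a \<in> carrier G" "b \<in> carrier G" "g \<in> carrier G"
  shows "comm (a \<otimes> b) g = a \<otimes> comm b g \<otimes> inv a \<otimes> comm a g"
  using assms by (simp add: comm_def word_simps)

lemma comm_mult_right:
  assumes "a \<in> carrier G" "b \<in> carrier G" "g \<in> carrier G"
  shows "comm g (a \<otimes> b) = comm g a \<otimes> a \<otimes> comm g b \<otimes> inv a"
  using assms by (simp add: comm_def word_simps)

lemma conj_eq_iff_commute: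
  assumes "a \<in> carrier G" "b \<in> carrier G"
  shows "a \<otimes> b \<otimes> inv a = b \<longleftrightarrow> a \<otimes> b = b \<otimes> a"
  using assms by (metis inv_solve_right m_closed)

lemma commute_mult_right:
  assumes "a \<in> carrier G" "b \<in> carrier G" "c \<in> carrier G"
    and "a \<otimes> b = b \<otimes> a" "a \<otimes> c = c \<otimes> a"
  shows "a \<otimes> (b \<otimes> c) = b \<otimes> c \<otimes> a"
  using assms by (metis m_assoc)

lemma commute_inv_right:
  assumes "a \<in> carrier G" "b \<in> carrier G" and "a \<otimes> b = b \<otimes> a"
  shows "a \<otimes> inv b = inv b \<otimes> a"
  using assms by (metis inv_closed inv_solve_left inv_solve_right m_assoc m_closed)

lemma commute_pow_right:
  assumes "a \<in> carrier G" "b \<in> carrier G" and "a \<otimes> b = b \<otimes> a"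
  shows "a \<otimes> b [^] (n::nat) = b [^] n \<otimes> a"
  using assms by (induction n) (simp_all add: commute_mult_right)

definition centralizer :: "'a set \<Rightarrow> 'a set"
  where "centralizer S = {a \<in> carrier G. \<forall>s\<in>S. a \<otimes> s = s \<otimes> a}"

lemma subgroup_centralizer:
  assumes "S \<subseteq> carrier G"
  shows "subgroup (centralizer S) G"
proof (rule subgroupI)
  show "centralizer S \<noteq> {}"
    using assms by (force simp: centralizer_def)
next
  fix a assume "a \<in> centralizer S"
  then show "inv a \<in> centralizer S"
    using assms unfolding centralizer_def
    by (smt (verit) commute_inv_right inv_closed mem_Collect_eq subset_iff)
next
  fix a b assume "a \<in> centralizer S" "b \<in> centralizer S"
  then show "a \<otimes> b \<in> centralizer S"
    using assms unfolding centralizer_def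
    by (smt (verit) commute_mult_right m_closed mem_Collect_eq subset_iff)
qed (auto simp: centralizer_def)

end

section \<open>2-Engel groups\<close>

text \<open>The 2-Engel law in the form that the inner automorphisms of an \<open>E\<close>-group
  supply; \<open>comm_comm_self\<close> turns it into [a,g,g] = 1.\<close>

locale two_engel = group +
  assumes conj_commute:
    "x \<in> carrier G \<Longrightarrow> g \<in> carrier G \<Longrightarrow>
      x \<otimes> (g \<otimes> x \<otimes> inv g) = g \<otimes> x \<otimes> inv g \<otimes> x"
begin

text \<open>[a,g] is \<open>a\<close> times the inverse of a conjugate of \<open>a\<close>, and
  \<open>a\<close> commutes with both factors.\<close>

lemma comm_commute_left:
  assumes "a \<in> carrier G" "g \<in> carrier G"
  shows "a \<otimes> comm a g = comm a g \<otimes> a"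
proof -
  have "a \<otimes> inv (g \<otimes> a \<otimes> inv g) = inv (g \<otimes> a \<otimes> inv g) \<otimes> a"
    using assms conj_commute by (intro commute_inv_right) auto
  moreover have "comm a g = a \<otimes> inv (g \<otimes> a \<otimes> inv g)"
    using assms by (simp add: comm_def word_simps)
  ultimately show ?thesis
    using assms by (metis commute_mult_right inv_closed m_closed)
qed

lemma comm_commute_right:
  assumes "a \<in> carrier G" "g \<in> carrier G"
  shows "g \<otimes> comm a g = comm a g \<otimes> g"
  using comm_commute_left[of g a] assms
  by (metis comm_closed commute_inv_right inv_comm_eq)

lemma comm_comm_self:
  assumes "a \<in> carrier G" "g \<in> carrier G"
  shows "comm (comm a g) g = \<one>" "comm (comm a g) a = \<one>"
  using assms comm_commute_left comm_commute_right by (simp_all add: comm_eq_one_iff)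

end

text \<open>On an abelian normal subgroup \<open>N\<close>, written additively, \<open>a \<mapsto> comm a g\<close> is the endomorphism
  \<open>1 - g\<close> of \<open>N\<close>; in a 2-Engel group its square vanishes.\<close>

locale two_engel_abelian_normal = two_engel +
  fixes N
  assumes subgroup_N: "subgroup N G"
    and conj_N: "a \<in> N \<Longrightarrow> g \<in> carrier G \<Longrightarrow> g \<otimes> a \<otimes> inv g \<in> N"
    and commute_N: "a \<in> N \<Longrightarrow> b \<in> N \<Longrightarrow> a \<otimes> b = b \<otimes> a"
begin

lemma N_carrier: "a \<in> N \<Longrightarrow> a \<in> carrier G"
  using subgroup.mem_carrier[OF subgroup_N] .

lemma N_closed [simp]:
  "\<one> \<in> N" "a \<in> N \<Longrightarrow> b \<in> N \<Longrightarrow> a \<otimes> b \<in> N" "a \<in> N \<Longrightarrow> inv a \<in> N"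
  using subgroup_N
  by (auto intro: subgroup.one_closed subgroup.m_closed subgroup.m_inv_closed)

lemma lcommute_N:
  assumes "a \<in> N" "b \<in> N" "c \<in> N"
  shows "a \<otimes> (b \<otimes> c) = b \<otimes> (a \<otimes> c)"
  using assms by (metis N_carrier commute_N m_assoc)

lemma comm_N [simp]:
  assumes "a \<in> N" "g \<in> carrier G"
  shows "comm a g \<in> N"
proof -
  have "comm a g = a \<otimes> (g \<otimes> inv a \<otimes> inv g)"
    using assms N_carrier by (simp add: comm_def word_simps)
  then show ?thesis
    using assms conj_N by simp
qed

lemma comm_mult_N:
  assumes "a \<in> N" "b \<in> N" "g \<in> carrier G"
  shows "comm (a \<otimes> b) g = comm a g \<otimes> comm b g"
proof -
  have "comm (a \<otimes> b) g = a \<otimes> comm b g \<otimes> inv a \<otimes> comm a g"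
    using assms N_carrier by (simp add: comm_mult_left)
  also have "a \<otimes> comm b g \<otimes> inv a = comm b g"
    using assms N_carrier conj_eq_iff_commute[of a "comm b g"] by (simp add: commute_N)
  finally show ?thesis
    using assms by (simp add: commute_N)
qed

lemma comm_inv_N:
  assumes "a \<in> N" "g \<in> carrier G"
  shows "comm (inv a) g = inv (comm a g)"
proof (rule inv_equality[symmetric])
  have "comm (inv a) g \<otimes> comm a g = comm (inv a \<otimes> a) g"
    using assms by (simp add: comm_mult_N)
  then show "comm (inv a) g \<otimes> comm a g = \<one>"
    using assms N_carrier by simp
qed (use assms N_carrier in auto)

text \<open>In the ring of endomorphisms of \<open>N\<close>: 1 - gh = (1 - g) + (1 - h) - (1 - g)(1
  - h).\<close>

lemma comm_mult_right_N:
  assumes "a \<in> N" "g \<in> carrier G" "h \<in> carrier G"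
  shows "comm a (g \<otimes> h) = comm a g \<otimes> (comm a h \<otimes> inv (comm (comm a h) g))"
proof -
  have "comm a (g \<otimes> h) = comm a g \<otimes> (g \<otimes> comm a h \<otimes> inv g)"
    using assms N_carrier by (simp add: comm_def word_simps)
  also have "g \<otimes> comm a h \<otimes> inv g = inv (comm (comm a h) g) \<otimes> comm a h"
    using assms N_carrier by (simp add: comm_def word_simps)
  finally show ?thesis
    using assms by (simp add: commute_N)
qed

text \<open>With Y = 1 - g and Z = 1 - h, the 2-Engel law for \<open>g\<close>, \<open>h\<close> and
  gh gives YY = ZZ = 0 and (Y + Z - YZ)^2 = 0. Expanding the square and cancelling leaves YZ + ZY =
  0, whence YZY = 0.\<close>

lemma comm_comm_flip:
  assumes "a \<in> N" "g \<in> carrier G" "h \<in> carrier G"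
  shows "comm (comm a h) g \<otimes> comm (comm a g) h = \<one>"
    and "comm (comm (comm a g) h) g = \<one>"
proof -
  define Y Z where "Y = (\<lambda>a. comm a g)" and "Z = (\<lambda>a. comm a h)"
  have N: "Y b \<in> N" "Z b \<in> N" if "b \<in> N" for b
    using that assms by (simp_all add: Y_def Z_def)
  have mult: "Y (b \<otimes> c) = Y b \<otimes> Y c" "Z (b \<otimes> c) = Z b \<otimes> Z c" if "b \<in> N" "c \<in> N" for b c
    using that assms by (simp_all add: Y_def Z_def comm_mult_N)
  have i: "Y (inv b) = inv (Y b)" "Z (inv b) = inv (Z b)" if "b \<in> N" for b
    using that assms by (simp_all add: Y_def Z_def comm_inv_N)
  have sq: "Y (Y b) = \<one>" "Z (Z b) = \<one>" if "b \<in> N" for b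
    using that assms N_carrier by (simp_all add: Y_def Z_def comm_comm_self)
  have one: "Y \<one> = \<one>" "Z \<one> = \<one>"
    using assms by (simp_all add: Y_def Z_def)
  have expand: "comm b (g \<otimes> h) = Y b \<otimes> (Z b \<otimes> inv (Y (Z b)))" if "b \<in> N" for b
    using that assms by (simp add: Y_def Z_def comm_mult_right_N)
  note rules = N N_carrier mult i sq one m_assoc inv_mult_group
  have main: "Y (Z b) \<otimes> (Z (Y b) \<otimes> (inv (Z (Y (Z b))) \<otimes>
      (inv (Y (Z (Y b))) \<otimes> Y (Z (Y (Z b)))))) = \<one>" if b: "b \<in> N" for b
  proof -
    have "\<one> = comm (comm b (g \<otimes> h)) (g \<otimes> h)"
      using b assms N_carrier by (simp add: comm_comm_self)
    also have "\<dots> = Y (Z b) \<otimes> (Z (Y b) \<otimes> (inv (Z (Y (Z b))) \<otimes>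
      (inv (Y (Z (Y b))) \<otimes> Y (Z (Y (Z b))))))"
      using b by (simp add: expand rules commute_N lcommute_N)
    finally show ?thesis by simp
  qed
  \<comment> \<open>Applying \<open>Y\<close> to the expanded square kills each term in which two
    \<open>Y\<close> become adjacent; only YZY - YZYZ = 0 survives.\<close>
  have YZY: "Y (Z (Y (Z b))) = Y (Z (Y b))" if b: "b \<in> N" for b
  proof -
    have "Y (Z (Y b)) \<otimes> inv (Y (Z (Y (Z b)))) = \<one>"
      using arg_cong[OF main[OF b], of Y] b by (simp add: rules)
    then show ?thesis
      using b N N_carrier by (metis inv_equality inv_inv inv_closed)
  qed
  have step: "Y (Z b) \<otimes> (Z (Y b) \<otimes> inv (Z (Y (Z b)))) = \<one>" if b: "b \<in> N" for b
    using main[OF b] b by (simp add: YZY N N_carrier)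
  \<comment> \<open>Applying \<open>Z\<close> to YZ + ZY - ZYZ = 0 kills the last two terms.\<close>
  have ZYZ: "Z (Y (Z b)) = \<one>" if b: "b \<in> N" for b
    using arg_cong[OF step[OF b], of Z] b by (simp add: rules)
  have flip: "Y (Z b) \<otimes> Z (Y b) = \<one>" if b: "b \<in> N" for b
    using step[OF b] b by (simp add: ZYZ N N_carrier)
  show "comm (comm a h) g \<otimes> comm (comm a g) h = \<one>"
    using flip[OF assms(1)] by (simp add: Y_def Z_def)
  show "comm (comm (comm a g) h) g = \<one>"
    using arg_cong[OF flip[OF assms(1)], of Y] assms(1)
    by (simp add: rules) (simp add: Y_def Z_def)
qed

end

section \<open>Conjugacy classes and an abelian normal subgroup around each element\<close>

context group
begin

definition conj_class :: "'a \<Rightarrow> 'a set"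
  where "conj_class x = {g \<otimes> x \<otimes> inv g | g. g \<in> carrier G}"

lemma conj_class_carrier: "x \<in> carrier G \<Longrightarrow> conj_class x \<subseteq> carrier G"
  by (auto simp: conj_class_def)

lemma conj_class_conj:
  assumes "x \<in> carrier G" "a \<in> conj_class x" "h \<in> carrier G"
  shows "h \<otimes> a \<otimes> inv h \<in> conj_class x"
proof -
  obtain g where g: "g \<in> carrier G" "a = g \<otimes> x \<otimes> inv g"
    using assms by (auto simp: conj_class_def)
  then have "h \<otimes> a \<otimes> inv h = (h \<otimes> g) \<otimes> x \<otimes> inv (h \<otimes> g)"
    using assms by (simp add: word_simps)
  then show ?thesis
    using g assms by (auto simp: conj_class_def)
qed

lemma centralizer_antimono: "S \<subseteq> S' \<Longrightarrow> centralizer S' \<subseteq> centralizer S"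
  by (auto simp: centralizer_def)

lemma centralizer_commute: "a \<in> centralizer S \<Longrightarrow> s \<in> S \<Longrightarrow> a \<otimes> s = s \<otimes> a"
  by (simp add: centralizer_def)

lemma centralizer_conj:
  assumes "S \<subseteq> carrier G" "\<And>s g. s \<in> S \<Longrightarrow> g \<in> carrier G \<Longrightarrow> g \<otimes> s \<otimes> inv g \<in> S"
    and "a \<in> centralizer S" "g \<in> carrier G"
  shows "g \<otimes> a \<otimes> inv g \<in> centralizer S"
proof -
  have "g \<otimes> a \<otimes> inv g \<otimes> s = s \<otimes> (g \<otimes> a \<otimes> inv g)" if s: "s \<in> S" for s
  proof -
    let ?t = "inv g \<otimes> s \<otimes> g"
    have car: "a \<in> carrier G" "s \<in> carrier G"
      using assms s by (auto simp: centralizer_def)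
    have "?t \<in> S"
      using assms(2)[OF s, of "inv g"] assms(4) by simp
    then have "a \<otimes> ?t = ?t \<otimes> a"
      using assms(3) by (simp add: centralizer_def)
    then have "g \<otimes> (a \<otimes> ?t) \<otimes> inv g = g \<otimes> (?t \<otimes> a) \<otimes> inv g"
      by simp
    then show ?thesis
      using car assms(4) by (simp add: word_simps)
  qed
  then show ?thesis
    using assms by (auto simp: centralizer_def)
qed

end

context two_engel
begin

lemma conj_class_commute:
  assumes x: "x \<in> carrier G" and "a \<in> conj_class x" "b \<in> conj_class x"
  shows "a \<otimes> b = b \<otimes> a"
proof -
  obtain g h where g: "g \<in> carrier G" "a = g \<otimes> x \<otimes> inv g"
    and h: "h \<in> carrier G" "b = h \<otimes> x \<otimes> inv h"
    using assms by (auto simp: conj_class_def)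
  have "b = (h \<otimes> inv g) \<otimes> a \<otimes> inv (h \<otimes> inv g)"
    using g h x by (simp add: word_simps)
  then show ?thesis
    using conj_commute[of a "h \<otimes> inv g"] g h x by simp
qed

text \<open>The double centralizer of the conjugacy class of \<open>x\<close> serves. It is normal
  because the class is closed under conjugation. As the class is commutative, it lies in its
  centralizer \<open>?C\<close>, so \<open>?N\<close> lies in \<open>?C\<close> as well, and
  \<open>?N\<close> centralizes \<open>?C\<close>.\<close>

lemma abelian_normal_exists:
  assumes x: "x \<in> carrier G"
  obtains N where "two_engel_abelian_normal G N" "x \<in> N"
proof -
  let ?C = "centralizer (conj_class x)"
  let ?N = "centralizer ?C"
  have C: "?C \<subseteq> carrier G"
    by (auto simp: centralizer_def)
  have sub: "conj_class x \<subseteq> ?C"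
    using x conj_class_carrier conj_class_commute by (auto simp: centralizer_def)
  have "two_engel_abelian_normal G ?N"
  proof (intro two_engel_abelian_normal.intro two_engel_axioms
      two_engel_abelian_normal_axioms.intro)
    show "subgroup ?N G"
      by (rule subgroup_centralizer[OF C])
    fix a assume a: "a \<in> ?N"
    show "g \<otimes> a \<otimes> inv g \<in> ?N" if "g \<in> carrier G" for g
      using a that x conj_class_carrier conj_class_conj
      by (intro centralizer_conj C) auto
    show "a \<otimes> b = b \<otimes> a" if "b \<in> ?N" for b
      using a that centralizer_antimono[OF sub] by (blast intro: centralizer_commute)
  qed
  moreover have "\<one> \<otimes> x \<otimes> inv \<one> \<in> conj_class x"
    unfolding conj_class_def by blast
  then have "x \<in> ?N"
    using x by (auto simp: centralizer_def)
  ultimately show ?thesis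
    using that by blast
qed

section \<open>The left-normed commutator [x,y,z]: alternating, of exponent 3, central\<close>

abbreviation T :: "'a \<Rightarrow> 'a \<Rightarrow> 'a \<Rightarrow> 'a"
  where "T x y z \<equiv> comm (comm x y) z"

context
  fixes x y z
  assumes xyz [simp]: "x \<in> carrier G" "y \<in> carrier G" "z \<in> carrier G"
begin

text \<open>On an abelian normal subgroup containing \<open>x\<close>, the operators 1 - y and 1 - z
  anticommute.\<close>

lemma T_swap_right: "T x z y = inv (T x y z)"
proof -
  obtain N where "two_engel_abelian_normal G N" "x \<in> N"
    using abelian_normal_exists xyz by blast
  then interpret two_engel_abelian_normal G N by simp
  show ?thesis
    using comm_comm_flip(1)[of x y z] \<open>x \<in> N\<close> by (simp add: inv_equality)
qed

lemma comm_inv_T: "comm (inv (comm x y)) z = inv (T x y z)"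
proof -
  obtain N where "two_engel_abelian_normal G N" "x \<in> N"
    using abelian_normal_exists xyz by blast
  then interpret two_engel_abelian_normal G N by simp
  show ?thesis
    using \<open>x \<in> N\<close> by (simp add: comm_inv_N)
qed

lemma T_swap_left: "T y x z = inv (T x y z)"
  using comm_inv_T by (simp add: inv_comm_eq)

lemma T_commute: "y \<otimes> T x y z = T x y z \<otimes> y"
proof -
  obtain N where "two_engel_abelian_normal G N" "x \<in> N"
    using abelian_normal_exists xyz by blast
  then interpret two_engel_abelian_normal G N by simp
  show ?thesis
    using comm_comm_flip(2)[of x y z] \<open>x \<in> N\<close> by (simp add: comm_eq_one_iff)
qed

end

text \<open>A 3-cycle is a product of two transpositions, and each of these inverts the
  commutator.\<close>

lemma T_cyclic:
  assumes [simp]: "x \<in> carrier G" "y \<in> carrier G" "z \<in> carrier G"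
  shows "T x y z = T y z x"
  using T_swap_right[of z x y] T_swap_left[of z y x] T_swap_left[of z x y] T_swap_right[of x y z]
  by (metis assms comm_closed inv_inv)

text \<open>\<open>y\<close> commutes with both [x,y] and [x,y,z], so conjugating [x,y,z] by
  \<open>y\<close> changes nothing except the entry \<open>z\<close>.\<close>

lemma comm_comm_conj:
  assumes [simp]: "x \<in> carrier G" "y \<in> carrier G" "z \<in> carrier G"
  shows "comm (comm x y) (y \<otimes> z \<otimes> inv y) = T x y z"
proof -
  have "y \<otimes> comm x y \<otimes> inv y = comm x y"
    by (subst conj_eq_iff_commute) (simp_all add: comm_commute_right)
  moreover have "y \<otimes> T x y z \<otimes> inv y
      = comm (y \<otimes> comm x y \<otimes> inv y) (y \<otimes> z \<otimes> inv y)"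
    by (simp add: conj_comm)
  moreover have "y \<otimes> T x y z \<otimes> inv y = T x y z"
    by (subst conj_eq_iff_commute) (simp_all add: T_commute)
  ultimately show ?thesis by simp
qed

text \<open>The three factors of the Hall-Witt identity coincide by cyclic symmetry.\<close>

lemma T_cube:
  assumes [simp]: "x \<in> carrier G" "y \<in> carrier G" "z \<in> carrier G"
  shows "T x y z [^] (3::nat) = \<one>"
proof -
  have "T x y z \<otimes> T y z x \<otimes> T z x y = \<one>"
    using hall_witt[of x y z] by (simp add: comm_comm_conj)
  moreover have "T y z x = T x y z" "T z x y = T x y z"
    by (simp_all flip: T_cyclic)
  ultimately show ?thesis
    by (simp add: numeral_3_eq_3)
qed

text \<open>Cyclic shifts turn f = [x,y,z,t] into [[z,t],[x,y]], which is the inverse of [z,t,x,y];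
  two transpositions also turn f = [z,x,y,t] into [z,t,x,y]. So f is its own inverse, and f^3 = 1 by
  \<open>T_cube\<close>.\<close>

lemma comm_T:
  assumes [simp]: "x \<in> carrier G" "y \<in> carrier G" "z \<in> carrier G" "t \<in> carrier G"
  shows "comm (T x y z) t = \<one>"
proof -
  let ?f = "comm (T x y z) t"
  have "?f = T z t (comm x y)"
    by (simp add: T_cyclic[of "comm x y" z t])
  also have "\<dots> = inv (T x y (comm z t))"
    by (simp add: inv_comm_eq)
  also have "T x y (comm z t) = comm (T z t x) y"
    by (simp flip: T_cyclic[of "comm z t"])
  also have "\<dots> = ?f"
  proof -
    have "?f = comm (T z x y) t"
      by (simp add: T_cyclic[of z x y])
    also have "\<dots> = inv (comm (T z x t) y)"
      by (simp add: T_swap_right[of "comm z x" t y])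
    also have "\<dots> = comm (inv (T z x t)) y"
      by (simp add: comm_inv_T[of "comm z x" t y])
    also have "\<dots> = comm (T z t x) y"
      by (simp add: T_swap_right[of z x t])
    finally show ?thesis by simp
  qed
  finally have inv: "?f = inv ?f" .
  then have "?f \<otimes> ?f = \<one>"
    by (metis assms comm_closed l_inv)
  then show ?thesis
    using T_cube[of "comm x y" z t] by (simp add: numeral_3_eq_3)
qed

end

section \<open>Centre and derived subgroup\<close>

context group
begin

lemma comm_pow_left:
  assumes a: "a \<in> carrier G" "g \<in> carrier G" and ac: "a \<otimes> comm a g = comm a g \<otimes> a"
  shows "comm (a [^] (n::nat)) g = comm a g [^] n"
proof (induction n)
  case (Suc n)
  have "comm (a [^] Suc n) g = a [^] n \<otimes> comm a g \<otimes> inv (a [^] n) \<otimes> comm (a [^] n) g"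
    using a by (simp add: comm_mult_left)
  also have "a [^] n \<otimes> comm a g \<otimes> inv (a [^] n) = comm a g"
    using commute_pow_right[of "comm a g" a n] a ac by (subst conj_eq_iff_commute) auto
  also have "comm a g \<otimes> comm (a [^] n) g = comm a g [^] Suc n"
    using a Suc nat_pow_Suc2[of "comm a g" n] by simp
  finally show ?case .
qed (use a in simp)

abbreviation center :: "'a set"
  where "center \<equiv> centralizer (carrier G)"

lemma center_carrier: "z \<in> center \<Longrightarrow> z \<in> carrier G"
  by (simp add: centralizer_def)

lemma center_commute: "z \<in> center \<Longrightarrow> g \<in> carrier G \<Longrightarrow> z \<otimes> g = g \<otimes> z"
  by (simp add: centralizer_def)

lemma center_iff_comm:
  "z \<in> center \<longleftrightarrow> z \<in> carrier G \<and> (\<forall>g\<in>carrier G. comm z g = \<one>)"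
  by (auto simp: centralizer_def comm_eq_one_iff)

lemma comm_mult_left_center:
  assumes "a \<in> carrier G" "b \<in> carrier G" "g \<in> carrier G" "comm b g \<in> center"
  shows "comm (a \<otimes> b) g = comm a g \<otimes> comm b g"
proof -
  have "a \<otimes> comm b g \<otimes> inv a = comm b g"
    using assms by (subst conj_eq_iff_commute) (simp_all add: center_commute)
  then show ?thesis
    using assms by (simp add: comm_mult_left center_commute)
qed

lemma comm_mult_right_center:
  assumes "a \<in> carrier G" "b \<in> carrier G" "g \<in> carrier G" "comm g b \<in> center"
  shows "comm g (a \<otimes> b) = comm g a \<otimes> comm g b"
proof -
  have "a \<otimes> comm g b \<otimes> inv a = comm g b"
    using assms by (subst conj_eq_iff_commute) (simp_all add: center_commute)
  then show ?thesis
    using assms by (simp add: comm_mult_right m_assoc)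
qed

text \<open>While its values are central, commutation with a fixed \<open>g\<close> is
  multiplicative. Inclusions of the form [D,g] in \<open>A\<close> can thus be checked on generators
  of \<open>D\<close>.\<close>

lemma subgroup_comm_into:
  assumes A: "subgroup A G" "A \<subseteq> center" and S: "S \<subseteq> carrier G"
  shows "subgroup {d \<in> carrier G. \<forall>g\<in>S. comm d g \<in> A} G"
proof (rule subgroupI)
  show "{d \<in> carrier G. \<forall>g\<in>S. comm d g \<in> A} \<noteq> {}"
    using S subgroup.one_closed[OF A(1)] by (auto intro!: exI[of _ \<one>])
next
  fix a assume "a \<in> {d \<in> carrier G. \<forall>g\<in>S. comm d g \<in> A}"
  then have a: "a \<in> carrier G" "\<And>g. g \<in> S \<Longrightarrow> comm a g \<in> A"
    by auto
  have "comm (inv a) g \<in> A" if "g \<in> S" for g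
  proof -
    have "comm (inv a) g \<otimes> comm a g = comm (inv a \<otimes> a) g"
      using A S a that by (subst comm_mult_left_center) auto
    then have "comm (inv a) g = inv (comm a g)"
      using S a that by (simp add: inv_equality subset_iff)
    then show ?thesis
      using A a that by (simp add: subgroup.m_inv_closed)
  qed
  then show "inv a \<in> {d \<in> carrier G. \<forall>g\<in>S. comm d g \<in> A}"
    using a by simp
next
  fix a b
  assume "a \<in> {d \<in> carrier G. \<forall>g\<in>S. comm d g \<in> A}" "b \<in> {d \<in> carrier G. \<forall>g\<in>S. comm d g \<in> A}"
  then have "a \<in> carrier G" "b \<in> carrier G" "comm (a \<otimes> b) g \<in> A" if "g \<in> S" for g
    using A S that by (auto simp: subset_iff comm_mult_left_center subgroup.m_closed)
  then show "a \<otimes> b \<in> {d \<in> carrier G. \<forall>g\<in>S. comm d g \<in> A}"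
    using \<open>a \<in> _\<close> \<open>b \<in> _\<close> by auto
qed auto

abbreviation D :: "'a set"
  where "D \<equiv> derived G (carrier G)"

lemma subgroup_D: "subgroup D G"
  by (simp add: derived_is_subgroup)

lemma D_carrier: "d \<in> D \<Longrightarrow> d \<in> carrier G"
  using subgroup.mem_carrier[OF subgroup_D] .

lemma comm_in_D: "a \<in> carrier G \<Longrightarrow> b \<in> carrier G \<Longrightarrow> comm a b \<in> D"
  unfolding derived_def comm_def by (rule generate.incl) auto

lemma D_least:
  assumes "subgroup H G" "\<And>a b. a \<in> carrier G \<Longrightarrow> b \<in> carrier G \<Longrightarrow> comm a b \<in> H"
  shows "D \<subseteq> H"
  unfolding derived_def using assms by (intro generate_subgroup_incl) (auto simp: comm_def)

lemma subgroup_exponent_center: "subgroup {z \<in> center. z [^] (n::nat) = \<one>} G"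
proof (rule subgroupI)
  note Z = subgroup_centralizer[OF subset_refl]
  show "{z \<in> center. z [^] n = \<one>} \<noteq> {}"
    using subgroup.one_closed[OF Z] by (auto intro!: exI[of _ \<one>])
  show "inv a \<in> {z \<in> center. z [^] n = \<one>}" if "a \<in> {z \<in> center. z [^] n = \<one>}" for a
    using that subgroup.m_inv_closed[OF Z] center_carrier by (auto simp: nat_pow_inv)
  show "a \<otimes> b \<in> {z \<in> center. z [^] n = \<one>}"
    if "a \<in> {z \<in> center. z [^] n = \<one>}" "b \<in> {z \<in> center. z [^] n = \<one>}" for a b
    using that subgroup.m_closed[OF Z] center_carrier
    by (auto simp: pow_mult_distrib center_commute)
qed (auto simp: center_carrier)

end

context two_engel
begin

lemma T_center:
  "x \<in> carrier G \<Longrightarrow> y \<in> carrier G \<Longrightarrow> z \<in> carrier G \<Longrightarrow> T x y z \<in> center"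
  by (simp add: center_iff_comm comm_T)

lemma comm_D:
  assumes "d \<in> D" "g \<in> carrier G"
  shows "comm d g \<in> center" "comm d g [^] (3::nat) = \<one>"
proof -
  have "D \<subseteq> {d \<in> carrier G. \<forall>g\<in>carrier G. comm d g \<in> {z \<in> center. z [^] (3::nat) = \<one>}}"
    by (intro D_least subgroup_comm_into subgroup_exponent_center) (auto simp: T_center T_cube)
  then show "comm d g \<in> center" "comm d g [^] (3::nat) = \<one>"
    using assms by auto
qed

text \<open>Cyclic shifts rewrite [[u,v],[a,b]] as [a,b,u,v], which is trivial. Passing from
  commutators to \<open>D\<close> is done in one argument at a time.\<close>

lemma D_commute:
  assumes "d \<in> D" "e \<in> D"
  shows "d \<otimes> e = e \<otimes> d"
proof -
  have 1: "comm a b \<otimes> e = e \<otimes> comm a b" if "e \<in> D" and [simp]: "a \<in> carrier G" "b \<in> carrier G" for a b e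
  proof -
    have "D \<subseteq> centralizer {comm a b}"
    proof (intro D_least subgroup_centralizer)
      fix u v assume [simp]: "u \<in> carrier G" "v \<in> carrier G"
      have "comm (comm u v) (comm a b) = \<one>"
        by (simp add: T_cyclic[of u v "comm a b"] T_cyclic[of v "comm a b" u] comm_T)
      then show "comm u v \<in> centralizer {comm a b}"
        by (simp add: centralizer_def comm_eq_one_iff)
    qed auto
    then show ?thesis
      using that by (auto simp: centralizer_def)
  qed
  have "D \<subseteq> centralizer D"
    using 1 D_carrier by (intro D_least subgroup_centralizer) (auto simp: centralizer_def subgroup_self)
  then show ?thesis
    using assms by (auto simp: centralizer_def)
qed

text \<open>[d^3,g] = [d,g]^3 = 1.\<close>

lemma cube_D_center:
  assumes "d \<in> D"
  shows "d [^] (3::nat) \<in> center"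
  unfolding center_iff_comm
  using assms comm_D[OF assms] D_carrier[OF assms] by (simp add: comm_pow_left center_commute)

end

section \<open>Centrality of elements of prime order\<close>

context group
begin

lemma derived_supergroup_normal:
  assumes N: "subgroup N G" "D \<subseteq> N"
  shows "N \<lhd> G"
  unfolding normal_inv_iff
proof (intro conjI ballI)
  fix g n assume g: "g \<in> carrier G" and n: "n \<in> N"
  then have "g \<otimes> n \<otimes> inv g = comm g n \<otimes> n"
    using subgroup.mem_carrier[OF N(1)] by (simp add: comm_def word_simps)
  moreover have "comm g n \<in> N"
    using g n N subgroup.mem_carrier[OF N(1)] comm_in_D by blast
  ultimately show "g \<otimes> n \<otimes> inv g \<in> N"
    using n subgroup.m_closed[OF N(1)] by simp
qed (rule N)

text \<open>Take \<open>N\<close> maximal among the proper subgroups containing \<open>D\<close>;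
  such subgroups are normal. Adjoining an outside element whose \<open>p\<close>-th power lies in
  \<open>N\<close> must give all of \<open>G\<close>.\<close>

lemma subgroup_index_prime:
  fixes p :: nat
  assumes fin: "finite (carrier G)" and D: "D \<noteq> carrier G"
    and p_power: "\<And>x. x \<in> carrier G \<Longrightarrow> \<exists>n::nat. x [^] (p ^ n) = \<one>"
  obtains N x where "N \<lhd> G" "x \<in> carrier G" "x \<notin> N" "x [^] p \<in> N"
    "\<And>g. g \<in> carrier G \<Longrightarrow> \<exists>n\<in>N. \<exists>i::int. g = n \<otimes> x [^] i"
proof -
  let ?S = "{N. subgroup N G \<and> D \<subseteq> N \<and> N \<noteq> carrier G}"
  have "?S \<subseteq> Pow (carrier G)"
    by (auto dest: subgroup.mem_carrier)
  then have S: "finite ?S"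
    using fin by (simp add: finite_subset)
  have DS: "D \<in> ?S"
    using D subgroup_D by simp
  obtain N where "N \<in> ?S" and max: "\<forall>M\<in>?S. N \<subseteq> M \<longrightarrow> N = M"
    using finite_has_maximal2[OF S DS] by (elim bexE conjE)
  then have N: "subgroup N G" "D \<subseteq> N" "N \<noteq> carrier G"
    by auto
  then have normal: "N \<lhd> G"
    by (simp add: derived_supergroup_normal)
  obtain y where y: "y \<in> carrier G" "y \<notin> N"
    using N subgroup.subset by blast
  have "\<exists>n. y [^] (p ^ n) \<in> N"
    using p_power[OF y(1)] subgroup.one_closed[OF N(1)] by metis
  then obtain n where n: "y [^] (p ^ n) \<in> N" "\<And>m. m < n \<Longrightarrow> y [^] (p ^ m) \<notin> N"
    using exists_least_iff[of "\<lambda>n. y [^] (p ^ n) \<in> N"] by blast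
  then obtain m where m: "n = Suc m"
    using y by (cases n) auto
  \<comment> \<open>The last term of y, y^p, y^(p^2), ... before the sequence first enters
    \<open>N\<close>.\<close>
  define x where "x = y [^] (p ^ m)"
  have x: "x \<in> carrier G" "x \<notin> N" "x [^] p \<in> N"
    using y n m by (simp_all add: x_def nat_pow_pow mult.commute)
  let ?M = "N <#> generate G {x}"
  have M: "subgroup ?M G"
    using normal x by (intro mult_norm_subgroup generate_is_subgroup) auto
  have NM: "n \<otimes> x [^] i \<in> ?M" if "n \<in> N" for n and i :: int
    using that x by (auto simp: set_mult_def generate_pow)
  have "N \<subseteq> ?M"
    using NM[of _ 0] N subgroup.mem_carrier by fastforce
  moreover have "x \<in> ?M"
    using NM[of \<one> 1] x subgroup.one_closed[OF N(1)] by simp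
  ultimately have "?M = carrier G"
    using max[rule_format, of ?M] M N x by auto
  then have "\<exists>n\<in>N. \<exists>i::int. g = n \<otimes> x [^] i" if "g \<in> carrier G" for g
    using that x by (auto simp: set_mult_def generate_pow)
  then show ?thesis
    using that normal x by blast
qed

text \<open>If \<open>G/N\<close> is cyclic of order \<open>p\<close> generated by \<open>x\<close>, then \<open>n \<otimes> x [^] i \<mapsto> a [^] i\<close> is an endomorphism
  sending every element of the coset \<open>N #> x\<close> to \<open>a\<close>, and this coset generates \<open>G\<close>.\<close>

lemma order_prime_in_center:
  fixes p :: nat
  assumes fin: "finite (carrier G)" and D: "D \<noteq> carrier G" and p: "Factorial_Ring.prime p"
    and p_power: "\<And>x. x \<in> carrier G \<Longrightarrow> \<exists>n::nat. x [^] (p ^ n) = \<one>"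
    and endo: "\<And>\<alpha> x. \<alpha> \<in> hom G G \<Longrightarrow> x \<in> carrier G \<Longrightarrow> x \<otimes> \<alpha> x = \<alpha> x \<otimes> x"
    and a: "a \<in> carrier G" "a [^] p = \<one>"
  shows "a \<in> center"
proof -
  obtain N x where normal: "N \<lhd> G" and x: "x \<in> carrier G" "x \<notin> N" "x [^] p \<in> N"
    and ex: "\<And>g. g \<in> carrier G \<Longrightarrow> \<exists>n\<in>N. \<exists>i::int. g = n \<otimes> x [^] i"
    using subgroup_index_prime[OF fin D p_power] by blast
  interpret N: normal N G by fact
  \<comment> \<open>\<open>x\<close> has order exactly \<open>p\<close> modulo \<open>N\<close>: by
    Bezout, an exponent prime to \<open>p\<close> would put \<open>x\<close> itself into
    \<open>N\<close>.\<close>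
  have pow_N: "int p dvd i" if i: "x [^] i \<in> N" for i :: int
  proof (rule ccontr)
    assume "\<not> int p dvd i"
    then have "coprime i (int p)"
      using p by (metis coprime_commute prime_imp_coprime prime_nat_int_transfer)
    then obtain u v where uv: "u * i + v * int p = 1"
      using bezout_int[of i "int p"] by auto
    have "x = x [^] (u * i + v * int p)"
      using x(1) unfolding uv by simp
    also have "\<dots> = (x [^] i) [^] u \<otimes> (x [^] p) [^] v"
      using x int_pow_pow[of x i u] int_pow_pow[of x "int p" v]
      by (simp add: int_pow_mult int_pow_int mult.commute)
    also have "\<dots> \<in> N"
      using i x by (simp add: subgroup_int_pow_closed N.subgroup_axioms)
    finally show False
      using x by simp
  qed
  \<comment> \<open>The choice of exponent is harmless: two exponents for the same element differ by
    a multiple of \<open>p\<close>, and the order of \<open>a\<close> divides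
    \<open>p\<close>.\<close>
  define \<alpha> where "\<alpha> g = a [^] (SOME i::int. \<exists>n\<in>N. g = n \<otimes> x [^] i)" for g
  have \<alpha>: "\<alpha> (n \<otimes> x [^] i) = a [^] i" if n: "n \<in> N" for n and i :: int
  proof -
    let ?P = "\<lambda>j::int. \<exists>m\<in>N. n \<otimes> x [^] i = m \<otimes> x [^] j"
    have "?P (SOME j. ?P j)"
      using n by (intro someI[of ?P i]) blast
    then obtain m where m: "m \<in> N" "n \<otimes> x [^] i = m \<otimes> x [^] (SOME j. ?P j)"
      by blast
    define j where "j = (SOME j. ?P j)"
    have mj: "n \<otimes> x [^] i = m \<otimes> x [^] j"
      using m by (simp add: j_def)
    have "x [^] (i - j) = inv n \<otimes> (n \<otimes> x [^] i) \<otimes> inv (x [^] j)"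
      using n x by (simp add: int_pow_diff word_simps)
    also have "\<dots> = inv n \<otimes> m"
      unfolding mj using m n x by (simp add: word_simps)
    finally have "int p dvd i - j"
      using m n by (intro pow_N) simp
    moreover have "int (ord a) dvd int p"
      using a(2) pow_eq_id[OF a(1), of p] by simp
    ultimately have "int (ord a) dvd i - j"
      by (rule dvd_trans[rotated])
    then have "int (ord a) dvd j - i"
      by (simp add: dvd_diff_commute)
    then have "a [^] i = a [^] j"
      by (simp add: int_pow_eq[OF a(1)])
    then show ?thesis
      by (simp add: \<alpha>_def j_def)
  qed
  have \<alpha>_hom: "\<alpha> \<in> hom G G"
  proof (rule homI)
    show "\<alpha> g \<in> carrier G" for g
      using a by (simp add: \<alpha>_def)
    fix g h assume "g \<in> carrier G" "h \<in> carrier G"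
    then obtain n m and i j :: int
      where nm: "n \<in> N" "m \<in> N" and g: "g = n \<otimes> x [^] i" and h: "h = m \<otimes> x [^] j"
      using ex by meson
    let ?n = "n \<otimes> (x [^] i \<otimes> m \<otimes> inv (x [^] i))"
    have gh: "g \<otimes> h = ?n \<otimes> x [^] (i + j)"
      using nm x by (simp add: g h int_pow_mult word_simps)
    have "?n \<in> N"
      using nm x by (simp add: N.inv_op_closed2)
    then have "\<alpha> (g \<otimes> h) = a [^] (i + j)"
      unfolding gh by (rule \<alpha>)
    then show "\<alpha> (g \<otimes> h) = \<alpha> g \<otimes> \<alpha> h"
      using a nm by (simp add: g h \<alpha> int_pow_mult)
  qed
  have nx: "n \<otimes> x \<otimes> a = a \<otimes> (n \<otimes> x)" if "n \<in> N" for n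
  proof -
    have "\<alpha> (n \<otimes> x) = a"
      using \<alpha>[OF that, of 1] x a by simp
    then show ?thesis
      using endo[OF \<alpha>_hom, of "n \<otimes> x"] that x by simp
  qed
  have C: "subgroup (centralizer {a}) G"
    using a(1) subgroup_centralizer[of "{a}"] by simp
  have nxC: "n \<otimes> x \<in> centralizer {a}" if "n \<in> N" for n
    using nx[OF that] that x by (simp add: centralizer_def)
  have xC: "x \<in> centralizer {a}"
    using nxC[OF N.one_closed] x by simp
  \<comment> \<open>Both nx and \<open>x\<close> centralize \<open>a\<close>, hence so does their
    quotient.\<close>
  have nC: "n \<in> centralizer {a}" if "n \<in> N" for n
  proof -
    have "n \<otimes> x \<otimes> inv x \<in> centralizer {a}"
      by (intro subgroup.m_closed[OF C] subgroup.m_inv_closed[OF C] nxC xC that)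
    then show ?thesis
      using that x by (simp add: m_assoc)
  qed
  have "g \<in> centralizer {a}" if "g \<in> carrier G" for g
    using ex[OF that] subgroup_int_pow_closed[OF C xC] nC subgroup.m_closed[OF C]
    by blast
  then show ?thesis
    using a by (auto simp: centralizer_def)
qed

section \<open>Counting by fibres and cosets\<close>

lemma r_coset_eq_iff:
  assumes "subgroup K G" "a \<in> carrier G" "b \<in> carrier G"
  shows "K #> a = K #> b \<longleftrightarrow> a \<otimes> inv b \<in> K"
proof
  assume "K #> a = K #> b"
  then have "a \<in> K #> b"
    using assms rcos_self by blast
  then show "a \<otimes> inv b \<in> K"
    using assms subgroup.mem_carrier[OF assms(1)] by (auto simp: r_coset_def word_simps)
next
  assume "a \<otimes> inv b \<in> K"
  then have "(a \<otimes> inv b) \<otimes> b \<in> K #> b"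
    using assms by (intro rcosI subgroup.subset)
  then show "K #> a = K #> b"
    using assms repr_independence[of a K b] by (simp add: m_assoc)
qed

text \<open>Lagrange's theorem for a map whose fibres are the translates of \<open>K\<close>. This
  form covers coset maps, tuples of commutators and the cube map alike.\<close>

lemma card_image_kernel:
  assumes fin: "finite (carrier G)" and H: "subgroup H G" and K: "K \<subseteq> H"
    and eq: "\<And>a b. a \<in> H \<Longrightarrow> b \<in> H \<Longrightarrow> f a = f b \<longleftrightarrow> a \<otimes> inv b \<in> K"
  shows "card H = card (f ` H) * card K"
proof -
  have car: "h \<in> carrier G" if "h \<in> H" for h
    using subgroup.mem_carrier[OF H that] .
  have finH: "finite H"
    using fin H by (meson finite_subset subgroup.subset)
  have fibre: "card {a \<in> H. f a = f b} = card K" if b: "b \<in> H" for b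
  proof -
    have "{a \<in> H. f a = f b} = (\<lambda>k. k \<otimes> b) ` K"
    proof (intro equalityI subsetI)
      fix a assume a: "a \<in> {a \<in> H. f a = f b}"
      then have "a \<otimes> inv b \<in> K" "a = a \<otimes> inv b \<otimes> b"
        using b eq car by (auto simp: m_assoc)
      then show "a \<in> (\<lambda>k. k \<otimes> b) ` K"
        by blast
    next
      fix a assume "a \<in> (\<lambda>k. k \<otimes> b) ` K"
      then obtain k where k: "k \<in> K" "a = k \<otimes> b"
        by blast
      then have "a \<in> H" "a \<otimes> inv b = k"
        using K b car subgroup.m_closed[OF H] by (auto simp: m_assoc subset_iff)
      then show "a \<in> {a \<in> H. f a = f b}"
        using eq b k by simp
    qed
    moreover have "inj_on (\<lambda>k. k \<otimes> b) K"
      using K b car by (intro inj_onI) (auto simp: subset_iff)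
    ultimately show ?thesis
      by (simp add: card_image)
  qed
  have "card H = (\<Sum>y\<in>f ` H. card {a \<in> H. f a = y})"
    using sum.image_gen[OF finH, of "\<lambda>_. 1::nat" f] by simp
  also have "\<dots> = (\<Sum>y\<in>f ` H. card K)"
    by (intro sum.cong refl) (auto simp: fibre)
  finally show ?thesis
    by simp
qed

lemma card_cosets:
  assumes "finite (carrier G)" "subgroup H G" "subgroup K G" "K \<subseteq> H"
  shows "card H = card ((\<lambda>h. K #> h) ` H) * card K"
  using assms subgroup.mem_carrier[OF assms(2)]
  by (intro card_image_kernel) (simp_all add: r_coset_eq_iff)

end

section \<open>Groups of class three\<close>

context group
begin

lemma ord_eq_prime:
  fixes p :: nat
  assumes "Factorial_Ring.prime p" "a \<in> carrier G" "a [^] p = \<one>" "a \<noteq> \<one>"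
  shows "ord a = p"
proof -
  have "ord a dvd p"
    using assms(3) pow_eq_id[OF assms(2), of p] by simp
  moreover have "ord a \<noteq> 1"
    using assms(4) ord_eq_1[OF assms(2)] by simp
  ultimately show ?thesis
    using assms(1) by (metis prime_nat_iff)
qed

end

lemma card_ge_27:
  assumes "finite A" "card C = 3" "\<And>p q r. p \<in> C \<Longrightarrow> q \<in> C \<Longrightarrow> r \<in> C \<Longrightarrow> (p, q, r) \<in> A"
  shows "27 \<le> card A"
proof -
  have "card (C \<times> C \<times> C) \<le> card A"
    using assms by (intro card_mono) auto
  then show ?thesis
    using assms(2) by (simp add: card_cartesian_product)
qed

text \<open>The order of \<open>a\<close> is odd and not 1, so 1, \<open>a\<close> and its inverse
  are distinct and exhaust \<open>S\<close>.\<close>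

lemma small_quotient_inverse_cases:
  assumes Q: "group Q" and S: "subgroup S Q" "finite S" "card S \<le> 3"
    and ab: "a \<in> S" "b \<in> S" and a: "a [^]\<^bsub>Q\<^esub> ((3::nat) ^ m) = \<one>\<^bsub>Q\<^esub>" "a \<noteq> \<one>\<^bsub>Q\<^esub>"
  shows "b = \<one>\<^bsub>Q\<^esub> \<or> b = a \<or> b = inv\<^bsub>Q\<^esub> a"
proof -
  interpret Q: group Q by fact
  have car: "a \<in> carrier Q"
    using ab S by (simp add: subgroup.mem_carrier)
  have "a \<noteq> inv\<^bsub>Q\<^esub> a"
  proof
    assume "a = inv\<^bsub>Q\<^esub> a"
    then have "a \<otimes>\<^bsub>Q\<^esub> a = \<one>\<^bsub>Q\<^esub>"
      using car Q.r_inv by metis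
    then have "Q.ord a dvd 2"
      using car by (subst Q.pow_eq_id[symmetric]) (simp_all add: numeral_2_eq_2)
    moreover have "Q.ord a dvd 3 ^ m"
      using a(1) Q.pow_eq_id[OF car] by simp
    moreover have "coprime (2::nat) (3 ^ m)"
      by simp
    ultimately have "Q.ord a = 1"
      using coprime_common_divisor_nat by blast
    then show False
      using a(2) car Q.ord_eq_1 by blast
  qed
  moreover have "a \<noteq> \<one>\<^bsub>Q\<^esub>" "inv\<^bsub>Q\<^esub> a \<noteq> \<one>\<^bsub>Q\<^esub>"
    using a(2) car by auto
  ultimately have "card {\<one>\<^bsub>Q\<^esub>, a, inv\<^bsub>Q\<^esub> a} = 3"
    by auto
  moreover have "{\<one>\<^bsub>Q\<^esub>, a, inv\<^bsub>Q\<^esub> a} \<subseteq> S"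
    using ab S by (simp add: subgroup.one_closed subgroup.m_inv_closed)
  ultimately have "{\<one>\<^bsub>Q\<^esub>, a, inv\<^bsub>Q\<^esub> a} = S"
    using S(2,3) by (metis card_mono card_subset_eq le_antisym)
  then show ?thesis
    using ab by blast
qed

text \<open>A hypothetical counterexample to class 2. Of the \<open>E\<close>-property it retains
  the 2-Engel law and the centrality of elements of order 3.\<close>

locale class_three_witness = two_engel +
  fixes x y z c
  assumes xyz [simp]: "x \<in> carrier G" "y \<in> carrier G" "z \<in> carrier G"
    and fin: "finite (carrier G)"
    and three_power: "g \<in> carrier G \<Longrightarrow> \<exists>n. g [^] ((3::nat) ^ n) = \<one>"
    and order_three: "g \<in> carrier G \<Longrightarrow> g [^] (3::nat) = \<one> \<Longrightarrow> g \<in> center"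
    and c_def: "c = T x y z"
    and c_neq: "c \<noteq> \<one>"
begin

lemma c_closed [simp]: "c \<in> carrier G"
  by (simp add: c_def)

lemma T_c: "T x y z = c" "T y z x = c" "T z x y = c"
  by (simp_all add: c_def T_cyclic[of x y z] T_cyclic[of y z x])

abbreviation C :: "'a set"
  where "C \<equiv> generate G {c}"

lemma ord_c: "ord c = 3"
  using T_cube[of x y z] c_neq by (intro ord_eq_prime) (simp_all add: c_def)

lemma card_C: "card C = 3"
  using generate_pow_card[of c] ord_c by simp

lemma C_eq: "C = {c [^] k | k::nat. True}"
  using generate_pow_nat[of c] ord_c by auto

lemma subgroup_C: "subgroup C G"
  by (intro generate_is_subgroup) simp

lemma subgroup_center: "subgroup center G"
  by (intro subgroup_centralizer) simp

lemma C_center: "C \<subseteq> center"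
  using subgroup_center by (intro generate_subgroup_incl) (simp_all add: c_def T_center)

lemma center_pow: "w \<in> center \<Longrightarrow> w [^] (n::nat) \<in> center"
  by (induction n)
    (auto intro: subgroup.one_closed[OF subgroup_center] subgroup.m_closed[OF subgroup_center])

section \<open>Indices in the derived subgroup and the cube map\<close>

definition P :: "'a set"
  where "P = D \<inter> center"

lemma subgroup_P: "subgroup P G"
  unfolding P_def by (intro subgroups_Inter_pair subgroup_D subgroup_center)

lemma finite_D: "finite D"
  using fin D_carrier by (meson finite_subset subsetI)

lemma finite_P: "finite P"
  using finite_D by (simp add: P_def)

lemma comm_D_product:
  assumes "a \<in> D" "b \<in> D" "d \<in> D" "g \<in> carrier G"
  shows "comm (a [^] i \<otimes> b [^] j \<otimes> d [^] k) g
    = comm a g [^] (i::nat) \<otimes> comm b g [^] (j::nat) \<otimes> comm d g [^] (k::nat)"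
proof -
  have pow: "comm (e [^] n) g = comm e g [^] n" "comm e g [^] n \<in> center"
    if "e \<in> D" for e and n :: nat
    using that assms D_carrier comm_D(1)
    by (auto simp: comm_pow_left center_commute intro: center_pow)
  show ?thesis
    using assms D_carrier by (simp add: comm_mult_left_center pow)
qed

text \<open>The part of \<open>D\<close> whose commutators are controlled by \<open>c\<close>. The
  counting splits according to whether it is all of \<open>D\<close>.\<close>

definition W :: "'a set"
  where "W = generate G ({comm x y, comm y z, comm z x} \<union> P)"

lemma generators_W: "{comm x y, comm y z, comm z x} \<union> P \<subseteq> D"
  by (auto simp: P_def comm_in_D)

lemma subgroup_W: "subgroup W G"
  unfolding W_def using generators_W D_carrier by (intro generate_is_subgroup) blast

lemma W_subset_D: "W \<subseteq> D"
  unfolding W_def by (rule generate_subgroup_incl[OF generators_W subgroup_D])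

lemma P_subset_W: "P \<subseteq> W"
  unfolding W_def by (auto intro: generate.incl)

lemma W_pow: "w \<in> W \<Longrightarrow> w [^] (n::nat) \<in> W"
  by (induction n)
    (auto intro: subgroup.one_closed[OF subgroup_W] subgroup.m_closed[OF subgroup_W])

text \<open>Commutation with \<open>x\<close>, \<open>y\<close>, \<open>z\<close> maps
  \<open>W\<close> onto a set containing all triples from \<open>C\<close>, and \<open>P\<close>
  lies in the kernel.\<close>

lemma card_W: "27 * card P \<le> card W"
proof -
  define f where "f = (\<lambda>w. (comm w x, comm w y, comm w z))"
  let ?K = "{w \<in> W. f w = (\<one>, \<one>, \<one>)}"
  have inv: "comm (a \<otimes> inv b) g = \<one> \<longleftrightarrow> comm a g = comm b g"
    if "a \<in> W" "b \<in> W" and g: "g \<in> carrier G" for a b g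
  proof -
    have ab: "a \<in> carrier G" "b \<in> carrier G" "a \<otimes> inv b \<in> carrier G" "b \<in> D" "a \<otimes> inv b \<in> D"
      using that W_subset_D D_carrier subgroup.m_closed[OF subgroup_D]
        subgroup.m_inv_closed[OF subgroup_D] by (auto simp: subset_iff)
    have "comm a g = comm ((a \<otimes> inv b) \<otimes> b) g"
      using ab by (simp add: m_assoc)
    also have "\<dots> = comm (a \<otimes> inv b) g \<otimes> comm b g"
      using ab g by (simp add: comm_mult_left_center comm_D)
    finally show ?thesis
      using ab g by simp
  qed
  have W: "a \<otimes> inv b \<in> W" if "a \<in> W" "b \<in> W" for a b
    using that subgroup.m_closed[OF subgroup_W] subgroup.m_inv_closed[OF subgroup_W] by blast
  have "card W = card (f ` W) * card ?K"
    using fin subgroup_W by (intro card_image_kernel) (auto simp: f_def inv W)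
  moreover have "27 \<le> card (f ` W)"
  proof (rule card_ge_27[OF _ card_C])
    show "finite (f ` W)"
      using finite_D W_subset_D by (meson finite_imageI finite_subset)
    fix p q r assume "p \<in> C" "q \<in> C" "r \<in> C"
    then obtain i j k :: nat where ijk: "p = c [^] i" "q = c [^] j" "r = c [^] k"
      by (auto simp: C_eq)
    \<comment> \<open>Each basic commutator gives \<open>c\<close> with its missing generator and 1
      with the two it involves, so the three exponents can be prescribed independently.\<close>
    let ?w = "comm y z [^] i \<otimes> comm z x [^] j \<otimes> comm x y [^] k"
    have "f ?w = (p, q, r)"
      by (simp add: f_def comm_D_product comm_in_D ijk T_c comm_comm_self)
    moreover have "?w \<in> W"
      by (intro subgroup.m_closed[OF subgroup_W] W_pow) (auto simp: W_def intro: generate.incl)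
    ultimately show "(p, q, r) \<in> f ` W"
      by (metis image_eqI)
  qed
  moreover have "card P \<le> card ?K"
  proof (rule card_mono)
    show "finite ?K"
      using W_subset_D by (intro finite_subset[OF _ finite_D]) blast
    show "P \<subseteq> ?K"
      using P_subset_W by (auto simp: f_def P_def center_iff_comm)
  qed
  ultimately show ?thesis
    by (simp add: mult_le_mono)
qed

lemma card_P_pos: "0 < card P"
  using finite_P subgroup.one_closed[OF subgroup_P] by (auto simp: card_gt_0_iff)

lemma cube_mult_D:
  assumes "a \<in> D" "b \<in> D"
  shows "(a \<otimes> b) [^] (n::nat) = a [^] n \<otimes> b [^] n"
  using assms D_carrier by (intro pow_mult_distrib D_commute)

text \<open>The kernel of the cube map on \<open>D\<close> lies in the centre because elements of order 3 are central.\<close>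

lemma card_D:
  obtains n where "card D = n * card P" "n \<le> card ((\<lambda>d. d [^] (3::nat)) ` D)"
    "card ((\<lambda>d. d [^] (3::nat)) ` D) \<le> card P"
proof -
  define n where "n = card ((\<lambda>d. P #> d) ` D)"
  let ?f = "\<lambda>d. d [^] (3::nat)"
  let ?K = "{d \<in> D. d [^] (3::nat) = \<one>}"
  have n: "card D = n * card P"
    unfolding n_def using fin subgroup_D subgroup_P by (intro card_cosets) (auto simp: P_def)
  have "card D = card (?f ` D) * card ?K"
  proof (intro card_image_kernel fin subgroup_D)
    fix a b assume ab: "a \<in> D" "b \<in> D"
    then have car: "a \<in> carrier G" "b \<in> carrier G" "a \<otimes> inv b \<in> D"
      using D_carrier subgroup.m_closed[OF subgroup_D] subgroup.m_inv_closed[OF subgroup_D]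
      by auto
    have "a [^] (3::nat) = ((a \<otimes> inv b) \<otimes> b) [^] (3::nat)"
      using car by (simp add: m_assoc)
    also have "\<dots> = (a \<otimes> inv b) [^] (3::nat) \<otimes> b [^] (3::nat)"
      by (rule cube_mult_D) (use car ab in auto)
    finally have "a [^] (3::nat) = b [^] (3::nat) \<longleftrightarrow> (a \<otimes> inv b) [^] (3::nat) = \<one>"
      using car by simp
    then show "?f a = ?f b \<longleftrightarrow> a \<otimes> inv b \<in> ?K"
      using car by simp
  qed auto
  moreover have "card ?K \<le> card P"
    using finite_P D_carrier order_three by (intro card_mono) (auto simp: P_def)
  ultimately have "n * card P \<le> card (?f ` D) * card P"
    using n by simp
  then have "n \<le> card (?f ` D)"
    using card_P_pos by simp
  moreover have "?f d \<in> D" if "d \<in> D" for d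
    using that subgroup.m_closed[OF subgroup_D] subgroup.one_closed[OF subgroup_D]
    by (simp add: numeral_3_eq_3)
  then have "card (?f ` D) \<le> card P"
    using finite_P cube_D_center by (intro card_mono) (auto simp: P_def)
  ultimately show ?thesis
    using that n by blast
qed

text \<open>The centralizer of the three basic commutators. Lying between \<open>D\<close> and
  \<open>G\<close> with index at least 27 in \<open>G\<close>, and containing all cubes, it bounds
  the cubes of G/D.\<close>

definition L :: "'a set"
  where "L = {g \<in> carrier G. T y z g = \<one> \<and> T z x g = \<one> \<and> T x y g = \<one>}"

lemma T_mult_right:
  assumes "a \<in> carrier G" "b \<in> carrier G" "u \<in> carrier G" "v \<in> carrier G"
  shows "T u v (a \<otimes> b) = T u v a \<otimes> T u v b"
  using assms by (intro comm_mult_right_center) (simp_all add: T_center)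

lemma T_pow_right:
  assumes "a \<in> carrier G" "u \<in> carrier G" "v \<in> carrier G"
  shows "T u v (a [^] (n::nat)) = T u v a [^] n"
  using assms by (induction n) (simp_all add: T_mult_right)

lemma card_L: "27 * card L \<le> order G"
proof -
  define f where "f = (\<lambda>g. (T y z g, T z x g, T x y g))"
  have inv: "T u v (a \<otimes> inv b) = \<one> \<longleftrightarrow> T u v a = T u v b"
    if [simp]: "a \<in> carrier G" "b \<in> carrier G" "u \<in> carrier G" "v \<in> carrier G" for a b u v
  proof -
    have "T u v a = T u v ((a \<otimes> inv b) \<otimes> b)"
      by (simp add: m_assoc)
    also have "\<dots> = T u v (a \<otimes> inv b) \<otimes> T u v b"
      by (rule T_mult_right) simp_all
    finally show ?thesis
      by simp
  qed
  have "card (carrier G) = card (f ` carrier G) * card L"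
    using fin by (intro card_image_kernel subgroup_self) (auto simp: f_def inv L_def)
  moreover have "27 \<le> card (f ` carrier G)"
  proof (rule card_ge_27[OF _ card_C])
    fix p q r assume "p \<in> C" "q \<in> C" "r \<in> C"
    then obtain i j k :: nat where ijk: "p = c [^] i" "q = c [^] j" "r = c [^] k"
      by (auto simp: C_eq)
    \<comment> \<open>Dual to the count in \<open>W\<close>: [y,z,g] reads off the exponent of
      \<open>x\<close>, and cyclically.\<close>
    have "f (x [^] i \<otimes> y [^] j \<otimes> z [^] k) = (p, q, r)"
      by (simp add: f_def T_mult_right T_pow_right ijk T_c comm_comm_self)
    moreover have "x [^] i \<otimes> y [^] j \<otimes> z [^] k \<in> carrier G"
      by simp
    ultimately show "(p, q, r) \<in> f ` carrier G"
      by (metis image_eqI)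
  qed (use fin in auto)
  ultimately show ?thesis
    by (simp add: order_def)
qed

lemma D_subset_L: "D \<subseteq> L"
proof
  fix d assume d: "d \<in> D"
  have "T u v d = \<one>" if "u \<in> carrier G" "v \<in> carrier G" for u v
    using that d D_carrier comm_in_D by (simp add: comm_eq_one_iff D_commute)
  then show "d \<in> L"
    using d D_carrier by (simp add: L_def)
qed

lemma subgroup_L: "subgroup L G"
proof (rule subgroupI)
  show "inv a \<in> L" if "a \<in> L" for a
  proof -
    have "T u v (inv a) = \<one>" if "u \<in> carrier G" "v \<in> carrier G" "T u v a = \<one>" for u v
      using that \<open>a \<in> L\<close> by (simp add: L_def comm_eq_one_iff commute_inv_right)
    then show ?thesis
      using that by (simp add: L_def)
  qed
qed (auto simp: L_def T_mult_right intro: exI[of _ \<one>])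

lemma cube_in_L: "g \<in> carrier G \<Longrightarrow> g [^] (3::nat) \<in> L"
  by (simp add: L_def T_pow_right T_cube)

lemma finite_L: "finite L"
  using fin by (simp add: L_def)

section \<open>Excluding orders up to 3^10\<close>

lemma W_eq_D:
  assumes order: "order G \<le> 3 ^ 10"
  shows "W = D"
proof (rule ccontr)
  assume "W \<noteq> D"
  then obtain d where d: "d \<in> D" "d \<notin> W"
    using W_subset_D by blast
  have "W #> d \<noteq> W #> \<one>"
    using d D_carrier subgroup_W by (simp add: r_coset_eq_iff)
  moreover have "\<one> \<in> D"
    by (rule subgroup.one_closed[OF subgroup_D])
  ultimately have "card {W #> d, W #> \<one>} \<le> card ((\<lambda>d. W #> d) ` D)"
    using finite_D d by (intro card_mono) auto
  then have "2 \<le> card ((\<lambda>d. W #> d) ` D)"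
    using \<open>W #> d \<noteq> W #> \<one>\<close> by simp
  moreover have "card D = card ((\<lambda>d. W #> d) ` D) * card W"
    using fin subgroup_D subgroup_W W_subset_D by (intro card_cosets)
  ultimately have "2 * card W \<le> card D"
    by simp
  with card_W have le: "54 * card P \<le> card D"
    by simp
  obtain n where n: "card D = n * card P" "n \<le> card P"
    using card_D by (meson le_trans)
  then have "54 \<le> n"
    using le card_P_pos by simp
  then have "54 * 54 \<le> card D"
    unfolding n(1) using n(2) by (intro mult_le_mono) auto
  also have "\<dots> \<le> card L"
    using finite_L D_subset_L by (rule card_mono)
  \<comment> \<open>27 times 54^2 is 78732, which exceeds 3^10 = 59049.\<close>
  finally show False
    using card_L order by simp
qed

lemma D_subset_of_generators:
  assumes "W = D" "subgroup H G" "comm x y \<in> H" "comm y z \<in> H" "comm z x \<in> H" "P \<subseteq> H"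
  shows "D \<subseteq> H"
  using assms by (subst \<open>W = D\<close>[symmetric], unfold W_def, intro generate_subgroup_incl) auto

text \<open>Two passes over the generators of \<open>D\<close>: against \<open>x\<close>,
  \<open>y\<close>, \<open>z\<close> they give only 1 and \<open>c\<close>; a cyclic shift then
  admits an arbitrary second argument.\<close>

lemma comm_D_in_C:
  assumes W: "W = D" and d: "d \<in> D" and g: "g \<in> carrier G"
  shows "comm d g \<in> C"
proof -
  have C1: "\<one> \<in> C" "c \<in> C"
    using subgroup.one_closed[OF subgroup_C] by (auto intro: generate.incl)
  have P: "comm p h = \<one>" if "p \<in> P" "h \<in> carrier G" for p h
    using that by (simp add: P_def center_iff_comm)
  have 1: "comm e h \<in> C" if "e \<in> D" "h \<in> {x, y, z}" for e h
  proof -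
    have "D \<subseteq> {e \<in> carrier G. \<forall>h\<in>{x, y, z}. comm e h \<in> C}"
      using W subgroup_C C_center C1 P D_carrier
      by (intro D_subset_of_generators subgroup_comm_into)
        (auto simp: T_c comm_comm_self P_def)
    then show ?thesis
      using that by blast
  qed
  \<comment> \<open>[u,v,h] = [h,u,v], and [h,u] lies in \<open>D\<close>, so the first pass applies
    to \<open>v\<close>.\<close>
  have 2: "T u v h \<in> C" if "h \<in> carrier G" "u \<in> carrier G" "v \<in> {x, y, z}" for u v h
    using that 1[of "comm h u" v] T_cyclic[of h u v] by (auto simp: comm_in_D)
  have "D \<subseteq> {e \<in> carrier G. \<forall>h\<in>carrier G. comm e h \<in> C}"
    using W subgroup_C C_center C1 P D_carrier 2
    by (intro D_subset_of_generators subgroup_comm_into) (auto simp: P_def)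
  then show ?thesis
    using d g by blast
qed

text \<open>If g^3 lies in \<open>D\<close>, then [g,h]^3 = [g^3,h] lies in [D,G]. If u^3 is not in
  \<open>D\<close>, the image of \<open>L\<close> in G/D, of order at most 3, consists of the
  classes of 1, u^3 and u^-3, so v^3 is congruent to one of them.\<close>

lemma cube_comm_in_C:
  assumes W: "W = D" and L: "card L \<le> 3 * card D"
    and u: "u \<in> carrier G" and v: "v \<in> carrier G"
  shows "comm u v [^] (3::nat) \<in> C"
proof -
  let ?Q = "G Mod D"
  define \<phi> where "\<phi> = (\<lambda>g. D #> g)"
  interpret N: normal D G
    by (rule derived_self_is_normal)
  interpret Q: comm_group ?Q
    by (rule derived_quot_is_comm_group)
  interpret \<phi>: group_hom G ?Q \<phi>
    unfolding \<phi>_def by unfold_locales (rule N.r_coset_hom_Mod)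
  have ker: "\<phi> g = \<one>\<^bsub>?Q\<^esub> \<longleftrightarrow> g \<in> D" if "g \<in> carrier G" for g
    using that r_coset_eq_iff[OF subgroup_D that one_closed] D_carrier
    by (simp add: \<phi>_def FactGroup_def coset_mult_one subset_iff)
  have left: "comm g h [^] (3::nat) \<in> C"
    if "g [^] (3::nat) \<in> D" and gh: "g \<in> carrier G" "h \<in> carrier G" for g h
    using comm_D_in_C[OF W that(1) gh(2)] gh by (simp add: comm_pow_left comm_commute_left)
  have right: "comm g h [^] (3::nat) \<in> C"
    if "h [^] (3::nat) \<in> D" and gh: "g \<in> carrier G" "h \<in> carrier G" for g h
  proof -
    have "comm g h [^] (3::nat) = inv (comm h g [^] (3::nat))"
      using gh by (simp add: nat_pow_inv flip: inv_comm_eq[of h g])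
    then show ?thesis
      using left[OF that(1) gh(2,1)] subgroup.m_inv_closed[OF subgroup_C] by simp
  qed
  \<comment> \<open>Dividing \<open>v\<close> by an element \<open>w\<close> that commutes with
    \<open>u\<close> keeps [u,v], and in the abelian quotient it divides the cubes, so the new cube
    lies in \<open>D\<close>. This is used with \<open>w\<close> equal to 1, \<open>u\<close> and
    the inverse of \<open>u\<close>.\<close>
  have reduce: "comm u v [^] (3::nat) \<in> C"
    if w: "w \<in> carrier G" "comm u w = \<one>" and eq: "\<phi> (v [^] (3::nat)) = \<phi> (w [^] (3::nat))" for w
  proof -
    define k where "k = v \<otimes> inv w"
    have k: "k \<in> carrier G" "v = k \<otimes> w"
      using v w by (simp_all add: k_def m_assoc)
    have "\<phi> (v [^] (3::nat)) = \<phi> (k [^] (3::nat)) \<otimes>\<^bsub>?Q\<^esub> \<phi> (w [^] (3::nat))"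
      using k w Q.nat_pow_distrib[of "\<phi> k" "\<phi> w" 3] \<phi>.hom_closed
      by (simp add: \<phi>.hom_nat_pow)
    then have "\<phi> (k [^] (3::nat)) = \<one>\<^bsub>?Q\<^esub>"
      using eq k w Q.r_cancel_one'[of "\<phi> (w [^] (3::nat))" "\<phi> (k [^] (3::nat))"]
      by (metis \<phi>.hom_closed nat_pow_closed)
    then have "k [^] (3::nat) \<in> D"
      using k ker by simp
    moreover have "comm u v = comm u k"
      using u k w by (simp add: comm_mult_right m_assoc)
    ultimately show ?thesis
      using right u k by simp
  qed
  show ?thesis
  proof (cases "u [^] (3::nat) \<in> D")
    case False
    have "card L = card (\<phi> ` L) * card D"
      unfolding \<phi>_def using fin subgroup_L subgroup_D D_subset_L by (intro card_cosets)
    moreover have "D \<noteq> {}"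
      using subgroup.one_closed[OF subgroup_D] by blast
    ultimately have "card (\<phi> ` L) \<le> 3"
      using L finite_D by auto
    moreover have "subgroup (\<phi> ` L) ?Q"
      using subgroup_L by (rule \<phi>.subgroup_img_is_subgroup)
    moreover obtain m where m: "u [^] ((3::nat) ^ m) = \<one>"
      using three_power u by blast
    have "\<phi> (u [^] (3::nat)) [^]\<^bsub>?Q\<^esub> ((3::nat) ^ m) = \<phi> ((u [^] ((3::nat) ^ m)) [^] (3::nat))"
      using u by (simp add: nat_pow_pow mult.commute flip: \<phi>.hom_nat_pow)
    then have "\<phi> (u [^] (3::nat)) [^]\<^bsub>?Q\<^esub> ((3::nat) ^ m) = \<one>\<^bsub>?Q\<^esub>"
      using m by simp
    ultimately have "\<phi> (v [^] (3::nat)) = \<one>\<^bsub>?Q\<^esub> \<or> \<phi> (v [^] (3::nat)) = \<phi> (u [^] (3::nat))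
        \<or> \<phi> (v [^] (3::nat)) = inv\<^bsub>?Q\<^esub> \<phi> (u [^] (3::nat))"
      using finite_L u v cube_in_L False ker Q.is_group
      by (intro small_quotient_inverse_cases) auto
    moreover have "inv\<^bsub>?Q\<^esub> \<phi> (u [^] (3::nat)) = \<phi> (inv u [^] (3::nat))"
      using u by (simp add: nat_pow_inv)
    moreover have "\<phi> (\<one> [^] (3::nat)) = \<one>\<^bsub>?Q\<^esub>"
      by simp
    moreover have "comm u u = \<one>" "comm u (inv u) = \<one>"
      using u by (simp_all add: comm_eq_one_iff)
    ultimately show ?thesis
      using reduce[of \<one>] reduce[of u] reduce[of "inv u"] u by auto
  qed (use left u v in simp)
qed

lemma order_gt: "3 ^ 10 < order G"
proof (rule ccontr)
  assume "\<not> 3 ^ 10 < order G"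
  then have order: "order G \<le> 3 ^ 10"
    by simp
  then have W: "W = D"
    by (rule W_eq_D)
  let ?cubes = "(\<lambda>d. d [^] (3::nat)) ` D"
  obtain n where n: "card D = n * card P" "n \<le> card ?cubes" "card ?cubes \<le> card P"
    using card_D .
  have "27 \<le> n"
    using card_W card_P_pos n(1) W by simp
  then have "27 * 27 \<le> card D"
    unfolding n(1) using n(2,3) by (intro mult_le_mono) auto
  \<comment> \<open>|L| is at most 3^10 / 27 = 3^7, which is 3 times 27^2.\<close>
  then have L: "card L \<le> 3 * card D"
    using card_L order by simp
  \<comment> \<open>Cubing is multiplicative on the abelian group \<open>D\<close>, so it suffices
    to consider commutators.\<close>
  have "D \<subseteq> {d \<in> D. d [^] (3::nat) \<in> C}"
  proof (rule D_least)
    show "subgroup {d \<in> D. d [^] (3::nat) \<in> C} G"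
    proof (rule subgroupI)
      show "{d \<in> D. d [^] (3::nat) \<in> C} \<noteq> {}"
        using subgroup.one_closed[OF subgroup_D] subgroup.one_closed[OF subgroup_C]
        by (auto intro!: exI[of _ \<one>])
    qed (use D_carrier in \<open>auto simp: cube_mult_D nat_pow_inv
        intro: subgroup.m_closed[OF subgroup_D] subgroup.m_closed[OF subgroup_C]
          subgroup.m_inv_closed[OF subgroup_D] subgroup.m_inv_closed[OF subgroup_C]\<close>)
  qed (auto simp: comm_in_D cube_comm_in_C[OF W L])
  then have "?cubes \<subseteq> C"
    by auto
  then have "card ?cubes \<le> 3"
    using card_C by (metis card_mono card.infinite zero_neq_numeral)
  then show False
    using \<open>27 \<le> n\<close> n(2) by simp
qed

end

text \<open>\<open>order\<close> is 0 on an infinite carrier, so finiteness is stated separately and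
  the bound then refers to the true cardinality.\<close>

theorem theorem1p2:
  fixes G :: "('a, 'b) monoid_scheme"
  assumes "pE_group 3 G"
    and "finite (carrier G)" and "order G \<le> 3 ^ 10"
  shows "nilpotent_of_class_at_most 2 G"
proof -
  have G: "group G" and three: "\<And>x. x \<in> carrier G \<Longrightarrow> \<exists>n. group.ord G x = 3 ^ n"
    and endo: "\<And>\<alpha> x. \<alpha> \<in> hom G G \<Longrightarrow> x \<in> carrier G \<Longrightarrow> x \<otimes>\<^bsub>G\<^esub> \<alpha> x = \<alpha> x \<otimes>\<^bsub>G\<^esub> x"
    using assms(1) by (auto simp: pE_group_def E_group_def p_group_def)
  interpret group G by (rule G)
  have three_power: "\<exists>n::nat. x [^]\<^bsub>G\<^esub> ((3::nat) ^ n) = \<one>\<^bsub>G\<^esub>" if "x \<in> carrier G" for x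
    using three[OF that] pow_ord_eq_1[OF that] by metis
  \<comment> \<open>The \<open>E\<close>-property applied to inner automorphisms.\<close>
  interpret two_engel G
  proof unfold_locales
    fix x g assume xg: "x \<in> carrier G" "g \<in> carrier G"
    then have "(\<lambda>x. g \<otimes>\<^bsub>G\<^esub> x \<otimes>\<^bsub>G\<^esub> inv\<^bsub>G\<^esub> g) \<in> hom G G"
      by (intro homI) (simp_all add: word_simps)
    then show "x \<otimes>\<^bsub>G\<^esub> (g \<otimes>\<^bsub>G\<^esub> x \<otimes>\<^bsub>G\<^esub> inv\<^bsub>G\<^esub> g) = g \<otimes>\<^bsub>G\<^esub> x \<otimes>\<^bsub>G\<^esub> inv\<^bsub>G\<^esub> g \<otimes>\<^bsub>G\<^esub> x"
      using endo xg by blast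
  qed
  have T_one: "T x y z = \<one>\<^bsub>G\<^esub>" if xyz: "x \<in> carrier G" "y \<in> carrier G" "z \<in> carrier G" for x y z
  proof (rule ccontr)
    assume neq: "T x y z \<noteq> \<one>\<^bsub>G\<^esub>"
    \<comment> \<open>\<open>D\<close> is abelian, so a perfect \<open>G\<close> would have only
      trivial commutators.\<close>
    have "D \<noteq> carrier G"
    proof
      assume "D = carrier G"
      then have "T x y z = \<one>\<^bsub>G\<^esub>"
        using xyz by (simp add: comm_eq_one_iff D_commute)
      then show False
        using neq by simp
    qed
    then have "g \<in> center" if "g \<in> carrier G" "g [^]\<^bsub>G\<^esub> (3::nat) = \<one>\<^bsub>G\<^esub>" for g
      using order_prime_in_center[of 3 g] assms(2) three_power endo that by simp
    then interpret class_three_witness G x y z "T x y z"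
      using xyz assms(2) three_power neq by unfold_locales auto
    show False
      using order_gt assms(3) by simp
  qed
  \<comment> \<open>With indexing from 0, term 1 is the derived subgroup, and class at most 2 means
    that term 2, which is [D,G], is trivial.\<close>
  have lcs1: "lower_central_series G 1 = D"
    by (simp add: commutator_subgroup_def derived_def) (rule arg_cong[where f = "generate G"], blast)
  have "D \<subseteq> center"
    by (intro D_least subgroup_centralizer) (auto simp: center_iff_comm T_one)
  then have "{h \<otimes>\<^bsub>G\<^esub> k \<otimes>\<^bsub>G\<^esub> inv\<^bsub>G\<^esub> h \<otimes>\<^bsub>G\<^esub> inv\<^bsub>G\<^esub> k |h k. h \<in> D \<and> k \<in> carrier G} \<subseteq> {\<one>\<^bsub>G\<^esub>}"
    by (auto simp: center_iff_comm comm_def)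
  then have "lower_central_series G 2 \<subseteq> {\<one>\<^bsub>G\<^esub>}"
    using lcs1 generate_subgroup_incl[OF _ triv_subgroup]
    by (simp add: numeral_2_eq_2 commutator_subgroup_def)
  moreover have "\<one>\<^bsub>G\<^esub> \<in> lower_central_series G 2"
    by (simp add: numeral_2_eq_2 commutator_subgroup_def generate.one)
  ultimately show ?thesis
    using G by (auto simp: nilpotent_of_class_at_most_def)
qed

end
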